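(* Let $K\ge 1$, let $P=(p_{kl})$ be a substochastic $K\times K$ matrix with spectral radius less than $1$, let $\lambda_k>0$, $\mu_k>0$ ($k=1,\dots,K$), let $\nu=(I-P^T)^{-1}\lambda$, $\rho_k=\nu_k/\mu_k$, and assume $\rho_k<1$ for all $k$. Let $J\subset\{1,\dots,K\}$ and $\tilde\rho^{(J)}_l=e^{-\tilde\theta^{(J)}_l}$ for $l\in J$. The face $F_J$ is essential if and only if $$\tilde\rho^{(J)}_l\ge\rho_l\quad\text{for all } l\in J .$$ Equivalently, $F_J$ is essential if and only if, componentwise, $$(\rho_l^{-1}-1,\ l\in J)^T\ \ge\ (I-P_{J,J})^{-1}P_{J,J^c}\,(\rho_l^{-1}-1,\ l\notin J)^T .$$
   Context: Substochastic: nonnegative entries, row sums at most $1$. $\lambda=(\lambda_1,\dots,\lambda_K)^T$. For index sets $A,B$, $P_{A,B}$ is the submatrix of $P$ with rows in $A$ and columns in $B$; $J^c$ is the complement of $J$ in $\{1,\dots,K\}$; $I$ is an identity matrix of the appropriate size. $F_J=\{x\in\mathbb R^K: x_i=0 \text{ for } i\in J,\ x_i>0\text{ for } i\notin J\}$. For $\theta\in\mathbb R^K$, $h_k(\theta)=e^{-\theta_k}\bigl(\sum_{l=1}^K(e^{\theta_l}-1)p_{kl}+1\bigr)-1$ and, with $u^+=\max(u,0)$, $$H_J(\theta)=\sum_{k=1}^K(e^{\theta_k}-1)\lambda_k+\sum_{k\in J}h_k(\theta)^+\mu_k+\sum_{k\in J^c}h_k(\theta)\mu_k ,$$ a convex function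 with subdifferential $\partial H_J$. $\tilde\theta^{(J)}\in\mathbb R^K$ is the vector determined by $\tilde\theta^{(J)}_k=-\ln\rho_k$ for $k\notin J$ and $h_k(\tilde\theta^{(J)})=0$ for $k\in J$. The face $F_J$ is called essential if a trajectory with momentum $\tilde\theta^{(J)}$ passing through $F_J$ exists, i.e. if there is an absolutely continuous function $q$ on a time interval of positive length, with values in $F_J$, such that $\dot q(t)\in\partial H_J(\tilde\theta^{(J)})$ almost everywhere. *)

theory Defs
  imports "HOL-Analysis.Analysis"
begin

(* The index set {1..K} is an arbitrary finite type 'k, so K = CARD('k) \<ge> 1;
   p_kl is P $ k $ l. *)

subsection \<open>Matrices\<close>

definition substochastic :: "real^'k^'k \<Rightarrow> bool" where
  "substochastic P \<longleftrightarrow> (\<forall>k l. P $ k $ l \<ge> 0) \<and> (\<forall>k. (\<Sum>l\<in>UNIV. P $ k $ l) \<le> 1)"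

definition complex_eigenvalues :: "real^'k^'k \<Rightarrow> complex set" where
  "complex_eigenvalues A =
     {z. \<exists>v. v \<noteq> 0 \<and> (\<chi> i j. complex_of_real (A $ i $ j)) *v v = z *s v}"

definition spectral_radius :: "real^'k^'k \<Rightarrow> real" where
  "spectral_radius A = (SUP z\<in>complex_eigenvalues A. cmod z)"

(* A matrix with rows in A and columns in B is represented by its extension by zero to a
   full matrix, and a vector indexed by A by its extension by zero to a full vector.  On these
   representations the ordinary **, *v, - and \<le> are the operations on the small matrices
   and vectors. *)

definition submat :: "'k set \<Rightarrow> 'k set \<Rightarrow> real^'k^'k \<Rightarrow> real^'k^'k" where
  "submat A B M = (\<chi> i j. if i \<in> A \<and> j \<in> B then M $ i $ j else 0)"

definition subvec :: "'k set \<Rightarrow> real^'k \<Rightarrow> real^'k" where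
  "subvec A x = (\<chi> i. if i \<in> A then x $ i else 0)"

definition submat_one :: "'k set \<Rightarrow> real^'k^'k" where
  "submat_one A = submat A A (mat 1)"

(* The inverse among the matrices indexed by A \<times> A. *)
definition submat_inv :: "'k set \<Rightarrow> real^'k^'k \<Rightarrow> real^'k^'k" where
  "submat_inv A M = (THE N. submat A A N = N \<and> M ** N = submat_one A \<and> N ** M = submat_one A)"

subsection \<open>Convexity and absolute continuity\<close>

definition subdifferential :: "('a::real_inner \<Rightarrow> real) \<Rightarrow> 'a \<Rightarrow> 'a set" where
  "subdifferential f x = {v. \<forall>y. f y \<ge> f x + v \<bullet> (y - x)}"

(* Not the library's absolutely_continuous, which relates two measures. *)
definition abs_continuous_on :: "real set \<Rightarrow> (real \<Rightarrow> 'a::real_normed_vector) \<Rightarrow> bool" where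
  "abs_continuous_on T q \<longleftrightarrow>
     (\<forall>\<epsilon>>0. \<exists>\<delta>>0. \<forall>D. finite D \<and> (\<forall>(a, b)\<in>D. a \<le> b \<and> {a..b} \<subseteq> T) \<and>
        disjoint_family_on (\<lambda>(a, b). {a<..<b}) D \<and> (\<Sum>(a, b)\<in>D. b - a) < \<delta> \<longrightarrow>
        (\<Sum>(a, b)\<in>D. norm (q b - q a)) < \<epsilon>)"

subsection \<open>The network\<close>

definition nu :: "real^'k^'k \<Rightarrow> real^'k \<Rightarrow> real^'k" where
  "nu P lam = matrix_inv (mat 1 - transpose P) *v lam"

definition rho :: "real^'k^'k \<Rightarrow> real^'k \<Rightarrow> real^'k \<Rightarrow> real^'k" where
  "rho P lam mu = (\<chi> k. nu P lam $ k / mu $ k)"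

definition face :: "'k set \<Rightarrow> (real^'k) set" where
  "face J = {x. (\<forall>i\<in>J. x $ i = 0) \<and> (\<forall>i. i \<notin> J \<longrightarrow> x $ i > 0)}"

definition h :: "real^'k^'k \<Rightarrow> 'k \<Rightarrow> real^'k \<Rightarrow> real" where
  "h P k \<theta> = exp (- \<theta> $ k) * ((\<Sum>l\<in>UNIV. (exp (\<theta> $ l) - 1) * P $ k $ l) + 1) - 1"

definition H :: "real^'k^'k \<Rightarrow> real^'k \<Rightarrow> real^'k \<Rightarrow> 'k set \<Rightarrow> real^'k \<Rightarrow> real" where
  "H P lam mu J \<theta> =
     (\<Sum>k\<in>UNIV. (exp (\<theta> $ k) - 1) * lam $ k)
     + (\<Sum>k\<in>J. max (h P k \<theta>) 0 * mu $ k)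
     + (\<Sum>k\<in>-J. h P k \<theta> * mu $ k)"

definition theta_tilde :: "real^'k^'k \<Rightarrow> real^'k \<Rightarrow> real^'k \<Rightarrow> 'k set \<Rightarrow> real^'k" where
  "theta_tilde P lam mu J =
     (THE \<theta>. (\<forall>k. k \<notin> J \<longrightarrow> \<theta> $ k = - ln (rho P lam mu $ k)) \<and> (\<forall>k\<in>J. h P k \<theta> = 0))"

definition rho_tilde :: "real^'k^'k \<Rightarrow> real^'k \<Rightarrow> real^'k \<Rightarrow> 'k set \<Rightarrow> 'k \<Rightarrow> real" where
  "rho_tilde P lam mu J l = exp (- theta_tilde P lam mu J $ l)"

definition essential :: "real^'k^'k \<Rightarrow> real^'k \<Rightarrow> real^'k \<Rightarrow> 'k set \<Rightarrow> bool" where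
  "essential P lam mu J \<longleftrightarrow>
     (\<exists>T q. is_interval T \<and> (\<exists>a\<in>T. \<exists>b\<in>T. a < b) \<and> abs_continuous_on T q \<and> q ` T \<subseteq> face J \<and>
        (AE t in lebesgue. t \<in> T \<longrightarrow>
           (\<exists>v\<in>subdifferential (H P lam mu J) (theta_tilde P lam mu J).
              (q has_vector_derivative v) (at t within T))))"

end

theory Submission
  imports Defs
begin

subsection \<open>Substochastic matrices without eigenvalue 1\<close>

text \<open>A trajectory stays in \<open>face J\<close>, so at an interior time of differentiability
  its velocity vanishes on \<open>J\<close>; conversely, a subgradient vanishing on \<open>J\<close>
  is the velocity of a short segment in the face. Hence essentiality means that \<open>H\<close> has
  a subgradient vanishing on \<open>J\<close> at the momentum
  (\<open>essential_iff_subgradient\<close>).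

  Put r = exp \<theta> and u = r - 1. Then h_k = ((P u)_k - u_k) / r_k (\<open>h_eq\<close>), so the
  momentum corresponds to the u that equals 1/rho - 1 off \<open>J\<close> and satisfies P u = u on
  \<open>J\<close> (\<open>theta_tilde_eq\<close>). On \<open>J\<close> this u is the right-hand
  side of the matrix inequality, and \<open>rho_tilde\<close> is 1/(1 + u) there. Both criteria
  therefore read rho_l (1 + u_l) \<le> 1 for l in \<open>J\<close>.

  That this is the condition for the subgradient is \<open>subgradient_vanishing_on_iff\<close>. The
  traffic equations express the arrival term through nu (\<open>nu_inner_eq\<close>), and mu_k =
  nu_k r_k off \<open>J\<close>, with r taken at the momentum. For l in \<open>J\<close>, raising
  h_l alone among the h_k with k in \<open>J\<close> changes \<open>H\<close> at the rate mu_l / r_l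
  - nu_l, while the subgradient sees no change; so nu_l r_l \<le> mu_l. Under these inequalities,
  nu_k r_k h_k is a lower bound of max(h_k, 0) mu_k on \<open>J\<close>. The resulting smooth convex
  minorant touches \<open>H\<close> at the momentum, and its gradient nu_k (u_k - (P u)_k) vanishes
  on \<open>J\<close>.

  Unique solvability and signs for the linear equations on \<open>J\<close> come from
  \<open>minimum_principle\<close>.\<close>

lemma substochastic_eigenvalue_le_1:
  fixes P :: "real^'k^'k"
  assumes "substochastic P" and "z \<in> complex_eigenvalues P"
  shows "cmod z \<le> 1"
proof -
  obtain v where v: "v \<noteq> 0" "(\<chi> i j. complex_of_real (P $ i $ j)) *v v = z *s v"
    using assms(2) by (auto simp: complex_eigenvalues_def)
  define m where "m = Max (range (\<lambda>k. cmod (v $ k)))"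
  have "m \<in> range (\<lambda>k. cmod (v $ k))"
    unfolding m_def by (rule Max_in) auto
  then obtain k where k: "m = cmod (v $ k)" by auto
  have le: "cmod (v $ l) \<le> m" for l
    unfolding m_def by (rule Max_ge) auto
  have "m > 0"
  proof -
    obtain l where "v $ l \<noteq> 0" using v(1) by (auto simp: vec_eq_iff)
    then show ?thesis using le[of l] by (smt (verit) zero_less_norm_iff)
  qed
  have "z * v $ k = (\<Sum>l\<in>UNIV. complex_of_real (P $ k $ l) * v $ l)"
    using arg_cong[OF v(2), of "\<lambda>x. x $ k"] by (simp add: matrix_vector_mult_def)
  then have "cmod z * m = cmod (\<Sum>l\<in>UNIV. complex_of_real (P $ k $ l) * v $ l)"
    by (metis k norm_mult)
  also have "\<dots> \<le> (\<Sum>l\<in>UNIV. P $ k $ l * m)"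
    using assms(1) le
    by (intro order_trans[OF norm_sum] sum_mono)
       (auto simp: norm_mult substochastic_def intro!: mult_left_mono)
  also have "\<dots> \<le> 1 * m"
    using assms(1) \<open>m > 0\<close>
    by (subst sum_distrib_right[symmetric], intro mult_right_mono) (auto simp: substochastic_def)
  finally show ?thesis using \<open>m > 0\<close> by simp
qed

lemma substochastic_fixed_point_eq_0:
  fixes P :: "real^'k^'k"
  assumes "substochastic P" and "spectral_radius P < 1" and "P *v x = x"
  shows "x = 0"
proof (rule ccontr)
  assume "x \<noteq> 0"
  define v where "v = (\<chi> i. complex_of_real (x $ i))"
  have "v \<noteq> 0" using \<open>x \<noteq> 0\<close> by (auto simp: v_def vec_eq_iff)
  moreover have "(\<chi> i j. complex_of_real (P $ i $ j)) *v v = 1 *s v"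
  proof -
    have "(\<Sum>j\<in>UNIV. P $ i $ j * x $ j) = x $ i" for i
      using arg_cong[OF assms(3), of "\<lambda>y. y $ i"] by (simp add: matrix_vector_mult_def)
    then show ?thesis
      by (simp add: vec_eq_iff v_def matrix_vector_mult_def flip: of_real_mult of_real_sum)
  qed
  ultimately have "1 \<in> complex_eigenvalues P" by (auto simp: complex_eigenvalues_def)
  \<comment> \<open>A real \<open>SUP\<close> is known to be an upper bound only for a set bounded
    above; the row-sum bound on eigenvalues supplies this.\<close>
  moreover have "bdd_above (cmod ` complex_eigenvalues P)"
    using substochastic_eigenvalue_le_1[OF assms(1)] by (auto intro!: bdd_aboveI)
  ultimately have "cmod 1 \<le> spectral_radius P"
    unfolding spectral_radius_def by (intro cSUP_upper)
  then show False using assms(2) by simp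
qed

lemma invertible_one_minus_substochastic:
  fixes P :: "real^'k^'k"
  assumes "substochastic P" and "spectral_radius P < 1"
  shows "invertible (mat 1 - P)"
proof -
  have "x = 0" if "(mat 1 - P) *v x = 0" for x
    using that substochastic_fixed_point_eq_0[OF assms, of x]
    by (simp add: matrix_vector_mult_diff_rdistrib)
  then show ?thesis
    by (meson invertible_left_inverse matrix_left_invertible_ker)
qed

text \<open>On the set where a negative minimum is attained the rows of \<open>P\<close> sum to 1 and stay inside the
  set. A solution of \<open>w - P w = 1\<close> cannot attain its minimum over such a set.\<close>
lemma minimum_principle:
  fixes P :: "real^'k^'k"
  assumes P: "substochastic P" and spec: "spectral_radius P < 1"
    and off: "\<And>k. k \<notin> J \<Longrightarrow> x $ k = 0"
    and super: "\<And>k. k \<in> J \<Longrightarrow> (P *v x) $ k \<le> x $ k"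
  shows "0 \<le> x $ k"
proof (rule ccontr)
  assume neg: "\<not> 0 \<le> x $ k"
  have P0: "P $ i $ j \<ge> 0" and P1: "(\<Sum>j\<in>UNIV. P $ i $ j) \<le> 1" for i j
    using P by (auto simp: substochastic_def)
  define m where "m = Min (range (\<lambda>k. x $ k))"
  have le: "m \<le> x $ l" for l
    unfolding m_def by (rule Min_le) auto
  then have "m < 0" using neg by (meson le_less_trans not_le)
  define S where "S = {l. x $ l = m}"
  have "m \<in> range (\<lambda>k. x $ k)"
    unfolding m_def by (rule Min_in) auto
  then have "S \<noteq> {}" by (auto simp: S_def)
  have closed: "(\<Sum>j\<in>UNIV. P $ i $ j) = 1 \<and> (\<forall>j. j \<notin> S \<longrightarrow> P $ i $ j = 0)" if "i \<in> S" for i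
  proof -
    have "x $ i = m" using that by (simp add: S_def)
    then have "i \<in> J" using off \<open>m < 0\<close> by force
    then have "(\<Sum>j\<in>UNIV. P $ i $ j * x $ j) \<le> m"
      using super \<open>x $ i = m\<close> by (force simp: matrix_vector_mult_def)
    \<comment> \<open>The left side is at most m. On the right, the deviations from m contribute
      nonnegatively, and m times a row sum at most 1 is at least m since m < 0. So both bounds are
      equalities.\<close>
    moreover have "(\<Sum>j\<in>UNIV. P $ i $ j * x $ j)
        = (\<Sum>j\<in>UNIV. P $ i $ j * (x $ j - m)) + m * (\<Sum>j\<in>UNIV. P $ i $ j)"
      by (simp add: algebra_simps sum_subtractf sum_distrib_left)
    moreover have ge: "P $ i $ j * (x $ j - m) \<ge> 0" for j
      using P0 le by simp
    moreover have "(\<Sum>j\<in>UNIV. P $ i $ j * (x $ j - m)) \<ge> 0"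
      using ge by (intro sum_nonneg)
    moreover have "m * (\<Sum>j\<in>UNIV. P $ i $ j) \<ge> m"
      using P1[of i] \<open>m < 0\<close> by (simp add: mult_le_cancel_left1)
    ultimately have "(\<Sum>j\<in>UNIV. P $ i $ j * (x $ j - m)) = 0" "m * (\<Sum>j\<in>UNIV. P $ i $ j) = m"
      by linarith+
    then show ?thesis
      using ge \<open>m < 0\<close> by (subst (asm) sum_nonneg_eq_0_iff) (auto simp: S_def)
  qed
  obtain B where B: "(mat 1 - P) ** B = mat 1"
    using invertible_one_minus_substochastic[OF P spec] by (auto simp: invertible_def)
  define w where "w = B *v 1"
  have "(mat 1 - P) *v w = 1"
    using B by (simp add: w_def matrix_vector_mul_assoc)
  then have "w = 1 + P *v w"
    by (simp add: matrix_vector_mult_diff_rdistrib diff_eq_eq)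
  have w: "w $ i = 1 + (\<Sum>j\<in>UNIV. P $ i $ j * w $ j)" for i
  proof -
    have "w $ i = (1 + P *v w) $ i"
      using \<open>w = 1 + P *v w\<close> by (rule arg_cong)
    also have "\<dots> = 1 + (\<Sum>j\<in>UNIV. P $ i $ j * w $ j)"
      by (simp add: matrix_vector_mult_def)
    finally show ?thesis .
  qed
  define a where "a = Min ((\<lambda>k. w $ k) ` S)"
  have "a \<in> (\<lambda>k. w $ k) ` S"
    unfolding a_def using \<open>S \<noteq> {}\<close> by (intro Min_in) auto
  then obtain i where i: "i \<in> S" "w $ i = a" by auto
  have "P $ i $ j * a \<le> P $ i $ j * w $ j" for j
  proof (cases "j \<in> S")
    case True
    then have "a \<le> w $ j" unfolding a_def by (intro Min_le) auto
    then show ?thesis using P0 by (intro mult_left_mono)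
  next
    case False
    then show ?thesis using closed[OF i(1)] by simp
  qed
  then have "(\<Sum>j\<in>UNIV. P $ i $ j * a) \<le> (\<Sum>j\<in>UNIV. P $ i $ j * w $ j)"
    by (intro sum_mono)
  then have "a + 1 \<le> w $ i"
    using closed[OF i(1)] w[of i] by (simp flip: sum_distrib_right)
  then show False using i(2) by simp
qed

text \<open>\<open>minimum_principle\<close> applies to both \<open>x\<close> and
  \<open>- x\<close>. This is the uniqueness statement behind the block inverse and the
  momentum.\<close>

lemma comparison_eq_0:
  fixes P :: "real^'k^'k"
  assumes P: "substochastic P" and spec: "spectral_radius P < 1"
    and off: "\<And>k. k \<notin> J \<Longrightarrow> x $ k = 0"
    and fix_on: "\<And>k. k \<in> J \<Longrightarrow> (P *v x) $ k = x $ k"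
  shows "x = 0"
proof -
  have "0 \<le> x $ k" for k
    using minimum_principle[OF P spec, of J x k] off fix_on by simp
  moreover have "0 \<le> (- x) $ k" for k
    using minimum_principle[OF P spec, of J "- x" k] off fix_on
    by (simp add: matrix_vector_mult_def sum_negf)
  ultimately show ?thesis by (simp add: vec_eq_iff antisym)
qed

subsection \<open>Principal submatrices\<close>

lemma submat_one_mult: "submat_one A ** M = (\<chi> i j. if i \<in> A then M $ i $ j else 0)"
proof -
  have "(\<Sum>k\<in>UNIV. submat_one A $ i $ k * M $ k $ j) = (if i \<in> A then M $ i $ j else 0)" for i j
  proof -
    have "(\<Sum>k\<in>UNIV. submat_one A $ i $ k * M $ k $ j)
        = (\<Sum>k\<in>UNIV. if k = i then (if i \<in> A then M $ i $ j else 0) else 0)"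
      by (rule sum.cong) (auto simp: submat_one_def submat_def mat_def)
    then show ?thesis by simp
  qed
  then show ?thesis by (simp add: matrix_matrix_mult_def vec_eq_iff)
qed

lemma mult_submat_one: "M ** submat_one A = (\<chi> i j. if j \<in> A then M $ i $ j else 0)"
proof -
  have "(\<Sum>k\<in>UNIV. M $ i $ k * submat_one A $ k $ j) = (if j \<in> A then M $ i $ j else 0)" for i j
  proof -
    have "(\<Sum>k\<in>UNIV. M $ i $ k * submat_one A $ k $ j)
        = (\<Sum>k\<in>UNIV. if k = j then (if j \<in> A then M $ i $ j else 0) else 0)"
      by (rule sum.cong) (auto simp: submat_one_def submat_def mat_def)
    then show ?thesis by simp
  qed
  then show ?thesis by (simp add: matrix_matrix_mult_def vec_eq_iff)
qed

lemma submat_one_mult_vec: "(submat_one A *v x) $ i = (if i \<in> A then x $ i else 0)"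
proof -
  have "(\<Sum>k\<in>UNIV. submat_one A $ i $ k * x $ k)
      = (\<Sum>k\<in>UNIV. if k = i then (if i \<in> A then x $ i else 0) else 0)"
    by (rule sum.cong) (auto simp: submat_one_def submat_def mat_def)
  then show ?thesis by (simp add: matrix_vector_mult_def)
qed

lemma submat_eq_mult: "submat A B M = submat_one A ** M ** submat_one B"
  by (simp add: submat_one_mult mult_submat_one submat_def vec_eq_iff)

lemma submat_one_idem: "submat_one A ** submat_one A = submat_one A"
  by (simp add: submat_one_mult) (simp add: submat_one_def submat_def vec_eq_iff)

text \<open>The zero-extended \<open>M\<close> is singular as a full matrix unless \<open>J\<close>
  is everything. Filling the complementary block with the identity gives \<open>A\<close>, which is
  invertible by \<open>comparison_eq_0\<close>; the \<open>J\<close> block of its inverse is the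
  inverse sought.\<close>

lemma submat_inv_correct:
  fixes P :: "real^'k^'k" and J :: "'k set"
  assumes P: "substochastic P" and spec: "spectral_radius P < 1"
  defines "M \<equiv> submat_one J - submat J J P"
  shows "submat J J (submat_inv J M) = submat_inv J M"
    and "M ** submat_inv J M = submat_one J"
    and "submat_inv J M ** M = submat_one J"
proof -
  let ?E = "submat_one J"
  define A where "A = mat 1 - submat J J P"
  have "x = 0" if "A *v x = 0" for x
  proof -
    have x: "submat J J P *v x = x"
      using that by (simp add: A_def matrix_vector_mult_diff_rdistrib)
    have xk: "x $ k = (\<Sum>j\<in>UNIV. (if k \<in> J \<and> j \<in> J then P $ k $ j else 0) * x $ j)" for k
      by (subst x[symmetric]) (simp add: matrix_vector_mult_def submat_def)
    have off: "x $ k = 0" if "k \<notin> J" for k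
      using that by (subst xk) simp
    show ?thesis
    proof (rule comparison_eq_0[OF P spec off])
      fix k assume "k \<in> J"
      then show "(P *v x) $ k = x $ k"
        using off by (subst xk) (auto simp: matrix_vector_mult_def intro!: sum.cong)
    qed
  qed
  then have "invertible A"
    by (meson invertible_left_inverse matrix_left_invertible_ker)
  then obtain B where B: "A ** B = mat 1" "B ** A = mat 1"
    by (auto simp: invertible_def)
  have EA: "?E ** A = M" and AE: "A ** ?E = M"
    by (simp_all add: submat_one_mult mult_submat_one)
       (auto simp: A_def M_def submat_one_def submat_def mat_def vec_eq_iff)
  define N where "N = submat J J B"
  \<comment> \<open>The projection \<open>?E\<close> commutes with \<open>A\<close>, hence with the
    inverse of \<open>A\<close>.\<close>
  have comm: "?E ** B = B ** ?E"
  proof -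
    have "?E ** B = B ** (A ** ?E) ** B" by (simp add: B matrix_mul_assoc)
    also have "\<dots> = B ** (?E ** A) ** B" by (simp only: EA AE)
    also have "\<dots> = B ** ?E ** (A ** B)" by (simp only: matrix_mul_assoc)
    finally show ?thesis by (simp add: B)
  qed
  have N1: "N = B ** ?E"
    unfolding N_def submat_eq_mult comm by (simp add: submat_one_idem flip: matrix_mul_assoc)
  have NEJ: "submat J J N = N"
    by (simp add: N_def submat_def vec_eq_iff)
  have "M ** N = ?E ** (A ** B) ** ?E"
    by (simp only: EA[symmetric] N1 matrix_mul_assoc)
  then have MN: "M ** N = ?E"
    by (simp add: B submat_one_idem)
  have "N ** M = ?E ** (B ** A) ** ?E"
    by (simp only: AE[symmetric] N1 comm[symmetric] matrix_mul_assoc)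
  then have NM: "N ** M = ?E"
    by (simp add: B submat_one_idem)
  have "submat_inv J M = N"
    unfolding submat_inv_def
  proof (rule the_equality)
    fix N' assume N': "submat J J N' = N' \<and> M ** N' = ?E \<and> N' ** M = ?E"
    then have "submat J J N' = N'" by blast
    then have "N' ** ?E = N'"
      by (simp add: mult_submat_one submat_def vec_eq_iff) metis
    then have "N' = N' ** (M ** N)" by (simp add: MN)
    also have "\<dots> = ?E ** N" using N' by (simp add: matrix_mul_assoc)
    also have "\<dots> = N"
      by (simp add: submat_one_mult N_def submat_def vec_eq_iff)
    finally show "N' = N" .
  qed (simp add: NEJ MN NM)
  then show "submat J J (submat_inv J M) = submat_inv J M"
    "M ** submat_inv J M = submat_one J" "submat_inv J M ** M = submat_one J"
    using NEJ MN NM by simp_all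
qed

text \<open>Translates the block inverse into a Dirichlet problem for the full matrix
  \<open>P\<close>, the form to which \<open>minimum_principle\<close> applies.\<close>

lemma submat_inv_solves:
  fixes P :: "real^'k^'k" and w :: "real^'k" and J :: "'k set"
  assumes P: "substochastic P" and spec: "spectral_radius P < 1"
  defines "y \<equiv> submat_inv J (submat_one J - submat J J P) *v w"
  shows "k \<notin> J \<Longrightarrow> y $ k = 0"
    and "k \<in> J \<Longrightarrow> y $ k = (P *v y) $ k + w $ k"
proof -
  let ?M = "submat_one J - submat J J P"
  note N = submat_inv_correct[OF P spec, of J]
  have off: "y $ k = 0" if "k \<notin> J" for k
    using that unfolding y_def
    by (subst N(1)[symmetric]) (simp add: matrix_vector_mult_def submat_def)
  then show "k \<notin> J \<Longrightarrow> y $ k = 0" .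
  have "?M *v y = submat_one J *v w"
    by (simp add: y_def matrix_vector_mul_assoc N)
  then have eq: "(submat_one J *v y) $ k - (submat J J P *v y) $ k = (submat_one J *v w) $ k"
    by (simp add: matrix_vector_mult_diff_rdistrib vec_eq_iff)
  assume "k \<in> J"
  then have "(submat J J P *v y) $ k = (P *v y) $ k"
    using off by (auto simp: submat_def matrix_vector_mult_def intro!: sum.cong)
  then show "y $ k = (P *v y) $ k + w $ k"
    using eq \<open>k \<in> J\<close> by (simp add: submat_one_mult_vec)
qed

subsection \<open>Trajectories\<close>

lemma essential_iff_subgradient:
  fixes P :: "real^'k^'k"
  shows "essential P lam mu J \<longleftrightarrow>
    (\<exists>v\<in>subdifferential (H P lam mu J) (theta_tilde P lam mu J). \<forall>j\<in>J. v $ j = 0)"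
    (is "_ \<longleftrightarrow> (\<exists>v\<in>?D. _)")
proof
  assume "essential P lam mu J"
  then obtain T q a b where T: "is_interval T" "a \<in> T" "b \<in> T" "a < b"
    and face: "q ` T \<subseteq> face J"
    and ae: "AE t in lebesgue. t \<in> T \<longrightarrow> (\<exists>v\<in>?D. (q has_vector_derivative v) (at t within T))"
    unfolding essential_def by blast
  have sub: "{a<..<b} \<subseteq> T"
    using T unfolding is_interval_1 by (meson greaterThanLessThan_iff less_imp_le subsetI)
  \<comment> \<open>A nonempty open interval has positive measure, so it is not contained in the
    exceptional null set.\<close>
  have "\<exists>t\<in>{a<..<b}. \<exists>v\<in>?D. (q has_vector_derivative v) (at t within T)"
  proof (rule ccontr)
    assume no: "\<not> ?thesis"
    have "AE t in lebesgue. t \<notin> {a<..<b}"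
      using ae by eventually_elim (use sub no in blast)
    then have "{a<..<b} \<in> null_sets lebesgue"
      by (subst AE_iff_null_sets) auto
    then have "emeasure lebesgue {a<..<b} = 0" by auto
    then show False using T(4) by simp
  qed
  then obtain t v where t: "t \<in> {a<..<b}" and v: "v \<in> ?D"
    and der: "(q has_vector_derivative v) (at t within T)" by blast
  have "v $ j = 0" if "j \<in> J" for j
  proof -
    have "((\<lambda>t. q t $ j) has_vector_derivative v $ j) (at t)"
      using bounded_linear.has_vector_derivative[OF bounded_linear_vec_nth
          has_vector_derivative_within_subset[OF der sub]]
      unfolding at_within_open[OF t open_greaterThanLessThan] .
    moreover have "((\<lambda>t. q t $ j) has_vector_derivative 0) (at t)"
    proof (rule has_vector_derivative_transform_within_open)
      show "((\<lambda>t. 0::real) has_vector_derivative 0) (at t)" by simp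
      show "open {a<..<b}" "t \<in> {a<..<b}" using t by auto
      show "0 = q s $ j" if "s \<in> {a<..<b}" for s
        using that sub face \<open>j \<in> J\<close> by (force simp: face_def)
    qed
    ultimately show ?thesis by (rule vector_derivative_unique_at)
  qed
  then show "\<exists>v\<in>?D. \<forall>j\<in>J. v $ j = 0" using v by blast
next
  assume "\<exists>v\<in>?D. \<forall>j\<in>J. v $ j = 0"
  then obtain v where v: "v \<in> ?D" and v0: "\<And>j. j \<in> J \<Longrightarrow> v $ j = 0" by blast
  \<comment> \<open>The segment starts at height 1 in every coordinate off \<open>J\<close>, and
    \<epsilon> keeps each displacement at most 1/2. The summand 1 in \<open>1 + norm v\<close>
    covers v = 0.\<close>
  define x where "x = subvec (-J) (1 :: real^'k)"
  define q where "q = (\<lambda>t. x + t *\<^sub>R v)"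
  define \<epsilon> where "\<epsilon> = 1 / (2 * (1 + norm v))"
  have "1 + norm v > 0" by (simp add: add_pos_nonneg)
  then have "\<epsilon> > 0" by (simp add: \<epsilon>_def)
  show "essential P lam mu J"
    unfolding essential_def
  proof (intro exI[of _ "{0..\<epsilon>}"] exI[of _ q] conjI)
    show "is_interval {0..\<epsilon>}" by (simp add: is_interval_cc)
    show "\<exists>a\<in>{0..\<epsilon>}. \<exists>b\<in>{0..\<epsilon>}. a < b"
      using \<open>\<epsilon> > 0\<close> by (intro bexI[of _ 0] bexI[of _ \<epsilon>]) auto
    show "abs_continuous_on {0..\<epsilon>} q"
      unfolding abs_continuous_on_def
    proof (intro allI impI)
      fix e :: real assume "e > 0"
      show "\<exists>\<delta>>0. \<forall>D. finite D \<and> (\<forall>(a, b)\<in>D. a \<le> b \<and> {a..b} \<subseteq> {0..\<epsilon>}) \<and>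
        disjoint_family_on (\<lambda>(a, b). {a<..<b}) D \<and> (\<Sum>(a, b)\<in>D. b - a) < \<delta> \<longrightarrow>
        (\<Sum>(a, b)\<in>D. norm (q b - q a)) < e"
      proof (intro exI[of _ "e / (1 + norm v)"] conjI allI impI; (elim conjE)?)
        show "e / (1 + norm v) > 0" using \<open>e > 0\<close> \<open>1 + norm v > 0\<close> by simp
        fix D :: "(real \<times> real) set"
        assume D: "\<forall>(a, b)\<in>D. a \<le> b \<and> {a..b} \<subseteq> {0..\<epsilon>}"
          and small: "(\<Sum>(a, b)\<in>D. b - a) < e / (1 + norm v)"
        have "(\<Sum>(a, b)\<in>D. norm (q b - q a)) \<le> (\<Sum>(a, b)\<in>D. (b - a) * (1 + norm v))"
        proof (rule sum_mono, clarify)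
          fix a b assume "(a, b) \<in> D"
          then have "a \<le> b" using D by blast
          moreover have "q b - q a = (b - a) *\<^sub>R v" by (simp add: q_def algebra_simps)
          ultimately show "norm (q b - q a) \<le> (b - a) * (1 + norm v)"
            by (simp add: mult_left_mono)
        qed
        also have "\<dots> = (\<Sum>(a, b)\<in>D. b - a) * (1 + norm v)"
          by (simp add: sum_distrib_right case_prod_unfold)
        also have "\<dots> < e"
          using small \<open>1 + norm v > 0\<close> by (simp add: pos_less_divide_eq)
        finally show "(\<Sum>(a, b)\<in>D. norm (q b - q a)) < e" .
      qed
    qed
    show "q ` {0..\<epsilon>} \<subseteq> face J"
    proof (clarsimp simp: face_def q_def x_def subvec_def v0)
      fix t i assume t: "0 \<le> t" "t \<le> \<epsilon>"
      have "\<bar>t * v $ i\<bar> \<le> \<epsilon> * (1 + norm v)"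
        using t component_le_norm_cart[of v i] unfolding abs_mult by (intro mult_mono) auto
      also have "\<dots> = 1 / 2" using \<open>1 + norm v > 0\<close> by (simp add: \<epsilon>_def field_simps)
      finally show "0 < 1 + t * v $ i" by linarith
    qed
    have "(q has_vector_derivative v) (at t within {0..\<epsilon>})" for t
      unfolding q_def by (auto intro!: derivative_eq_intros)
    then show "AE t in lebesgue. t \<in> {0..\<epsilon>} \<longrightarrow>
        (\<exists>v\<in>?D. (q has_vector_derivative v) (at t within {0..\<epsilon>}))"
      using v by auto
  qed
qed

subsection \<open>Traffic equations and momentum\<close>

lemma nu_eq:
  fixes P :: "real^'k^'k"
  assumes P: "substochastic P" and spec: "spectral_radius P < 1"
  shows "nu P lam $ k = lam $ k + (\<Sum>m\<in>UNIV. nu P lam $ m * P $ m $ k)"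
proof -
  have "transpose (mat 1 - P) = mat 1 - transpose P"
    by (auto simp: transpose_def vec_eq_iff mat_def)
  then have "invertible (mat 1 - transpose P)"
    using transpose_invertible[OF invertible_one_minus_substochastic[OF P spec]] by simp
  then have "(mat 1 - transpose P) ** matrix_inv (mat 1 - transpose P) = mat 1"
    unfolding matrix_inv_def invertible_def by (rule someI2_ex) simp
  then have "(mat 1 - transpose P) *v nu P lam = lam"
    by (simp add: nu_def matrix_vector_mul_assoc)
  then have "nu P lam = lam + transpose P *v nu P lam"
    by (simp add: matrix_vector_mult_diff_rdistrib diff_eq_eq)
  from arg_cong[OF this, of "\<lambda>x. x $ k"] show ?thesis
    by (simp add: matrix_vector_mult_def transpose_def mult.commute)
qed

text \<open>The traffic equations in weak form: lam = (I - P^T) nu is paired with a test vector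
  \<open>e\<close>.\<close>

lemma nu_inner_eq:
  fixes P :: "real^'k^'k"
  assumes P: "substochastic P" and spec: "spectral_radius P < 1"
  shows "(\<Sum>k\<in>UNIV. e $ k * lam $ k) = (\<Sum>k\<in>UNIV. nu P lam $ k * (e $ k - (P *v e) $ k))"
proof -
  have "(\<Sum>k\<in>UNIV. e $ k * lam $ k)
      = (\<Sum>k\<in>UNIV. e $ k * nu P lam $ k) - (\<Sum>k\<in>UNIV. \<Sum>m\<in>UNIV. e $ k * (nu P lam $ m * P $ m $ k))"
    by (subst (1) nu_eq[OF P spec])
       (simp add: distrib_left sum.distrib sum_distrib_left)
  also have "(\<Sum>k\<in>UNIV. \<Sum>m\<in>UNIV. e $ k * (nu P lam $ m * P $ m $ k))
      = (\<Sum>m\<in>UNIV. nu P lam $ m * (P *v e) $ m)"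
    by (subst sum.swap) (simp add: matrix_vector_mult_def sum_distrib_left ac_simps)
  finally show ?thesis by (simp add: right_diff_distrib sum_subtractf mult.commute)
qed

text \<open>Testing with e = (I - P)^{-1} applied to the l-th unit vector gives nu_l as the sum of
  e_k lam_k, where e is nonnegative and e_l > 0.\<close>

lemma nu_pos:
  fixes P :: "real^'k^'k"
  assumes P: "substochastic P" and spec: "spectral_radius P < 1"
    and lam: "\<And>k. lam $ k > 0"
  shows "nu P lam $ l > 0"
proof -
  define e where "e = submat_inv UNIV (submat_one UNIV - submat UNIV UNIV P) *v axis l 1"
  have e: "e $ k = (P *v e) $ k + axis l 1 $ k" for k
    using submat_inv_solves(2)[OF P spec, of k UNIV] by (simp add: e_def)
  have e0: "e $ k \<ge> 0" for k
    by (rule minimum_principle[OF P spec, where J = UNIV]) (auto simp: e axis_def)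
  have "(P *v e) $ l \<ge> 0"
    using P e0 by (auto simp: matrix_vector_mult_def substochastic_def intro!: sum_nonneg)
  then have "e $ l > 0" using e[of l] by (simp add: axis_def)
  have "nu P lam $ l = (\<Sum>k\<in>UNIV. nu P lam $ k * (e $ k - (P *v e) $ k))"
  proof -
    have "e $ k - (P *v e) $ k = axis l 1 $ k" for k using e[of k] by linarith
    then show ?thesis by (simp only:) (simp add: axis_def if_distrib cong: if_cong)
  qed
  also have "\<dots> = (\<Sum>k\<in>UNIV. e $ k * lam $ k)"
    by (rule nu_inner_eq[OF P spec, symmetric])
  also have "\<dots> > 0"
    using e0 \<open>e $ l > 0\<close> lam
    by (intro sum_pos2[of UNIV l]) (auto intro: mult_nonneg_nonneg less_imp_le)
  finally show ?thesis .
qed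

lemma h_eq:
  "h P k (\<chi> l. ln (r l)) = ((P *v (\<chi> l. r l - 1)) $ k - (r k - 1)) / r k" if "\<And>l. r l > 0"
proof -
  have "h P k (\<chi> l. ln (r l)) = 1 / r k * ((P *v (\<chi> l. r l - 1)) $ k + 1) - 1"
    using that by (simp add: h_def matrix_vector_mult_def mult.commute exp_minus inverse_eq_divide)
  also have "\<dots> = ((P *v (\<chi> l. r l - 1)) $ k - (r k - 1)) / r k"
    using that[of k] by (simp add: divide_simps)
  finally show ?thesis .
qed

text \<open>Resolves the \<open>THE\<close> in \<open>theta_tilde\<close>. For any solution
  \<theta>, the vector exp \<theta> - 1 - u vanishes off \<open>J\<close> and is fixed by
  \<open>P\<close> on \<open>J\<close>, so it is zero.\<close>

lemma theta_tilde_eq: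
  fixes P :: "real^'k^'k"
  assumes P: "substochastic P" and spec: "spectral_radius P < 1"
    and rho: "\<And>k. rho P lam mu $ k > 0"
    and u: "\<And>k. u $ k \<ge> 0"
    and off: "\<And>k. k \<notin> J \<Longrightarrow> u $ k = inverse (rho P lam mu $ k) - 1"
    and harm: "\<And>k. k \<in> J \<Longrightarrow> (P *v u) $ k = u $ k"
  shows "theta_tilde P lam mu J = (\<chi> k. ln (1 + u $ k))"
  unfolding theta_tilde_def
proof (rule the_equality)
  have pos: "1 + u $ k > 0" for k using u[of k] by simp
  show "(\<forall>k. k \<notin> J \<longrightarrow> (\<chi> k. ln (1 + u $ k)) $ k = - ln (rho P lam mu $ k)) \<and>
      (\<forall>k\<in>J. h P k (\<chi> k. ln (1 + u $ k)) = 0)"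
    using rho by (simp add: off ln_inverse h_eq[OF pos] harm)
  fix \<theta> assume \<theta>: "(\<forall>k. k \<notin> J \<longrightarrow> \<theta> $ k = - ln (rho P lam mu $ k)) \<and> (\<forall>k\<in>J. h P k \<theta> = 0)"
  define x where "x = (\<chi> k. exp (\<theta> $ k) - 1) - u"
  have "x = 0"
  proof (rule comparison_eq_0[OF P spec])
    fix k assume "k \<notin> J"
    then show "x $ k = 0"
      using \<theta> rho by (simp add: x_def off exp_minus)
  next
    fix k assume "k \<in> J"
    then have "h P k (\<chi> l. ln (exp (\<theta> $ l))) = 0" using \<theta> by simp
    then have "(P *v (\<chi> l. exp (\<theta> $ l) - 1)) $ k = exp (\<theta> $ k) - 1"
      by (subst (asm) h_eq) auto
    then show "(P *v x) $ k = x $ k"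
      using harm[OF \<open>k \<in> J\<close>] by (simp add: x_def matrix_vector_mult_diff_distrib)
  qed
  then have "exp (\<theta> $ k) = 1 + u $ k" for k
    by (simp add: x_def vec_eq_iff algebra_simps)
  then show "\<theta> = (\<chi> k. ln (1 + u $ k))"
    by (metis (mono_tags, lifting) ln_exp vec_lambda_unique)
qed

section \<open>Subgradients of \<open>H\<close> vanishing on \<open>J\<close>\<close>

text \<open>In the coordinates \<open>r = exp \<theta>\<close> each \<open>r\<^sub>k h\<^sub>k\<close> is affine. Necessity comes from the segment
  \<open>r + t e\<close>, with \<open>e\<close> supported in \<open>J\<close>, along which \<open>h\<^sub>k\<close> stays zero for all \<open>k \<in> J\<close> except \<open>k = l\<close>
  and a subgradient vanishing on \<open>J\<close> sees no change. Sufficiency takes the gradient of the smooth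
  minorant of \<open>H\<close> in which \<open>max (h\<^sub>k) 0\<close> is replaced by \<open>\<rho>\<^sub>k r\<^sub>k h\<^sub>k\<close>.\<close>
lemma subgradient_vanishing_on_iff:
  fixes P :: "real^'k^'k" and u :: "real^'k" and J :: "'k set"
  assumes P: "substochastic P" and spec: "spectral_radius P < 1"
    and lam: "\<And>k. lam $ k > 0" and mu: "\<And>k. mu $ k > 0"
    and u: "\<And>k. u $ k \<ge> 0"
    and off: "\<And>k. k \<notin> J \<Longrightarrow> u $ k = inverse (rho P lam mu $ k) - 1"
    and harm: "\<And>k. k \<in> J \<Longrightarrow> (P *v u) $ k = u $ k"
  shows "(\<exists>v\<in>subdifferential (H P lam mu J) (\<chi> k. ln (1 + u $ k)). \<forall>j\<in>J. v $ j = 0) \<longleftrightarrow>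
    (\<forall>l\<in>J. rho P lam mu $ l * (1 + u $ l) \<le> 1)"
    (is "(\<exists>v\<in>subdifferential ?H ?\<theta>. _) \<longleftrightarrow> _")
proof -
  let ?nu = "\<lambda>k. nu P lam $ k"
  define r where "r k = 1 + u $ k" for k
  have r: "r k > 0" for k using u[of k] by (simp add: r_def)
  have nu: "?nu k > 0" for k by (rule nu_pos[OF P spec lam])
  have rho_mu: "rho P lam mu $ k * mu $ k = ?nu k" for k
    using mu[of k] by (simp add: rho_def)
  have rho: "rho P lam mu $ k > 0" for k
    using nu mu by (simp add: rho_def)
  \<comment> \<open>Off \<open>J\<close> the momentum has r = 1/rho = mu/nu.\<close>
  have mu_off: "mu $ k = ?nu k * r k" if "k \<notin> J" for k
    using rho[of k] rho_mu[of k] by (simp add: r_def off[OF that] field_simps)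
  have expln: "exp (?\<theta> $ k) = r k" for k using r[of k] by (simp add: r_def)
  have \<theta>_r: "?\<theta> = (\<chi> k. ln (r k))" by (simp add: r_def)
  have u_r: "(\<chi> l. r l - 1) = u" by (simp add: r_def vec_eq_iff)
  have h0: "h P k ?\<theta> = ((P *v u) $ k - u $ k) / r k" for k
    unfolding \<theta>_r using h_eq[of r P k] r by (simp add: u_r) (simp add: r_def)
  have H0: "?H ?\<theta> = (\<Sum>k\<in>UNIV. u $ k * lam $ k) + (\<Sum>k\<in>-J. h P k ?\<theta> * mu $ k)"
    unfolding H_def expln by (simp add: h0 harm r_def)
  show ?thesis
  proof
    assume "\<exists>v\<in>subdifferential ?H ?\<theta>. \<forall>j\<in>J. v $ j = 0"
    then obtain v where v: "\<And>y. ?H y \<ge> ?H ?\<theta> + v \<bullet> (y - ?\<theta>)" and v0: "\<And>j. j \<in> J \<Longrightarrow> v $ j = 0"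
      by (auto simp: subdifferential_def)
    show "\<forall>l\<in>J. rho P lam mu $ l * (1 + u $ l) \<le> 1"
    proof
      fix l assume l: "l \<in> J"
      define e where "e = submat_inv J (submat_one J - submat J J P) *v (- axis l 1)"
      have e_off: "e $ k = 0" if "k \<notin> J" for k
        using submat_inv_solves(1)[OF P spec that] by (simp add: e_def)
      have e_on: "(P *v e) $ k - e $ k = (if k = l then 1 else 0)" if "k \<in> J" for k
        using submat_inv_solves(2)[OF P spec that, of "- axis l 1"] by (simp add: e_def axis_def)
      \<comment> \<open>The change per unit t of the part of \<open>H\<close> without positive
        parts. By the weak traffic equations everything cancels except the unit source at l.\<close>
      have drift: "(\<Sum>k\<in>UNIV. e $ k * lam $ k) + (\<Sum>k\<in>-J. ?nu k * (P *v e) $ k) = - ?nu l"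
      proof -
        have "(\<Sum>k\<in>UNIV. e $ k * lam $ k)
            = (\<Sum>k\<in>J. ?nu k * (e $ k - (P *v e) $ k)) + (\<Sum>k\<in>-J. ?nu k * (e $ k - (P *v e) $ k))"
          unfolding nu_inner_eq[OF P spec]
          by (subst sum.union_disjoint[symmetric]) auto
        also have "(\<Sum>k\<in>J. ?nu k * (e $ k - (P *v e) $ k)) = (\<Sum>k\<in>J. if k = l then - ?nu l else 0)"
        proof (rule sum.cong)
          fix k assume "k \<in> J"
          then have "e $ k - (P *v e) $ k = - (if k = l then 1 else 0)" using e_on by force
          then show "?nu k * (e $ k - (P *v e) $ k) = (if k = l then - ?nu l else 0)"
            by (simp only:) simp
        qed simp
        also have "\<dots> = - ?nu l" using l by simp
        also have "(\<Sum>k\<in>-J. ?nu k * (e $ k - (P *v e) $ k)) = - (\<Sum>k\<in>-J. ?nu k * (P *v e) $ k)"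
          by (simp add: e_off sum_negf)
        finally show ?thesis by simp
      qed
      have le: "?nu l * (r l + t * e $ l) \<le> mu $ l"
        if "t > 0" and pos: "\<And>k. r k + t * e $ k > 0" for t
      proof -
        define \<theta>' where "\<theta>' = (\<chi> k. ln (r k + t * e $ k))"
        have "(\<chi> k. r k + t * e $ k - 1) = u + t *\<^sub>R e" by (simp add: r_def vec_eq_iff)
        then have Pe: "(P *v (\<chi> k. r k + t * e $ k - 1)) $ k = (P *v u) $ k + t * (P *v e) $ k" for k
          by (simp add: matrix_vector_right_distrib matrix_vector_mult_scaleR)
        have h': "h P k \<theta>' = ((P *v u) $ k - u $ k + t * ((P *v e) $ k - e $ k)) / (r k + t * e $ k)" for k
          unfolding \<theta>'_def h_eq[OF pos] Pe by (simp add: r_def algebra_simps)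
        have J: "(\<Sum>k\<in>J. max (h P k \<theta>') 0 * mu $ k) = t * mu $ l / (r l + t * e $ l)"
        proof -
          have "(\<Sum>k\<in>J. max (h P k \<theta>') 0 * mu $ k)
              = (\<Sum>k\<in>J. if k = l then t * mu $ l / (r l + t * e $ l) else 0)"
            using pos[of l] \<open>t > 0\<close> by (intro sum.cong) (auto simp: h' harm e_on)
          then show ?thesis using l by simp
        qed
        have "(\<Sum>k\<in>-J. h P k \<theta>' * mu $ k)
            = (\<Sum>k\<in>-J. h P k ?\<theta> * mu $ k + t * (?nu k * (P *v e) $ k))"
        proof (rule sum.cong)
          fix k assume "k \<in> -J"
          then show "h P k \<theta>' * mu $ k = h P k ?\<theta> * mu $ k + t * (?nu k * (P *v e) $ k)"
            using r[of k] by (simp add: h' h0 e_off mu_off) (simp add: algebra_simps)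
        qed simp
        then have off_J: "(\<Sum>k\<in>-J. h P k \<theta>' * mu $ k)
            = (\<Sum>k\<in>-J. h P k ?\<theta> * mu $ k) + t * (\<Sum>k\<in>-J. ?nu k * (P *v e) $ k)"
          by (simp add: sum.distrib sum_distrib_left)
        have "(\<Sum>k\<in>UNIV. (exp (\<theta>' $ k) - 1) * lam $ k)
            = (\<Sum>k\<in>UNIV. u $ k * lam $ k) + t * (\<Sum>k\<in>UNIV. e $ k * lam $ k)"
          unfolding sum_distrib_left sum.distrib[symmetric]
          using pos by (intro sum.cong) (auto simp: \<theta>'_def r_def algebra_simps)
        then have "?H \<theta>' - ?H ?\<theta> = t * mu $ l / (r l + t * e $ l)
            + t * ((\<Sum>k\<in>UNIV. e $ k * lam $ k) + (\<Sum>k\<in>-J. ?nu k * (P *v e) $ k))"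
          unfolding H0 unfolding H_def J off_J by (simp add: algebra_simps)
        also have "\<dots> = t * (mu $ l / (r l + t * e $ l) - ?nu l)"
          unfolding drift by (simp add: algebra_simps)
        finally have diff: "?H \<theta>' - ?H ?\<theta> = t * (mu $ l / (r l + t * e $ l) - ?nu l)" .
        have "v \<bullet> (\<theta>' - ?\<theta>) = 0"
          unfolding inner_vec_def
        proof (rule sum.neutral, rule ballI)
          fix k show "v $ k \<bullet> (\<theta>' - ?\<theta>) $ k = 0"
            by (cases "k \<in> J") (auto simp: v0 e_off \<theta>'_def r_def)
        qed
        then have "0 \<le> t * (mu $ l / (r l + t * e $ l) - ?nu l)"
          using v[of \<theta>'] diff by simp
        then have "?nu l \<le> mu $ l / (r l + t * e $ l)"
          using \<open>t > 0\<close> by (simp add: zero_le_mult_iff)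
        then show ?thesis using pos[of l] by (simp add: pos_le_divide_eq)
      qed
      \<comment> \<open>For small t > 0 all coordinates stay positive, so \<open>le\<close> applies
        and passes to the limit.\<close>
      have lim: "((\<lambda>t. r k + t * e $ k) \<longlongrightarrow> r k) (at_right 0)" for k
        by (auto intro!: tendsto_eq_intros)
      have "eventually (\<lambda>t. \<forall>k. r k + t * e $ k > 0) (at_right 0)"
        by (rule eventually_all_finite) (rule order_tendstoD(1)[OF lim r])
      then have "eventually (\<lambda>t. ?nu l * (r l + t * e $ l) \<le> mu $ l) (at_right 0)"
        using eventually_at_right_less[of "0::real"] by eventually_elim (use le in blast)
      then have "?nu l * r l \<le> mu $ l"
        by (intro tendsto_upperbound[OF tendsto_mult[OF tendsto_const lim]]) auto
      then show "rho P lam mu $ l * (1 + u $ l) \<le> 1"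
        using mu[of l] by (simp add: rho_def r_def)
    qed
  next
    assume bound: "\<forall>l\<in>J. rho P lam mu $ l * (1 + u $ l) \<le> 1"
    \<comment> \<open>The gradient of the smooth minorant at the momentum.\<close>
    define v where "v = (\<chi> k. ?nu k * (u $ k - (P *v u) $ k))"
    have "?H y \<ge> ?H ?\<theta> + v \<bullet> (y - ?\<theta>)" for y
    proof -
      define d where "d = y - ?\<theta>"
      \<comment> \<open>The first-order change of exp \<theta> in the direction
        \<open>d\<close>.\<close>
      define rd where "rd = (\<chi> k. r k * d $ k)"
      have exp_y: "exp (y $ k) = r k * exp (d $ k)" for k
        by (simp add: d_def exp_diff flip: expln)
      have tangent: "exp x \<ge> 1 + x" for x :: real by (rule exp_ge_add_one_self)
      have arrivals: "(exp (y $ k) - 1) * lam $ k \<ge> u $ k * lam $ k + rd $ k * lam $ k" for k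
      proof -
        have "r k * (1 + d $ k) \<le> exp (y $ k)"
          unfolding exp_y using r[of k] tangent by (intro mult_left_mono) auto
        then have "(u $ k + rd $ k) * lam $ k \<le> (exp (y $ k) - 1) * lam $ k"
          using lam[of k] by (intro mult_right_mono) (auto simp: rd_def r_def algebra_simps)
        then show ?thesis by (simp add: distrib_right)
      qed
      \<comment> \<open>Up to a constant, r_k h_k is a combination of exponentials of linear
        functions of \<open>d\<close> with nonnegative coefficients, the exit probability
        \<open>s\<close> among them. Each exponential is bounded below by its tangent.\<close>
      have services: "r k * h P k y \<ge> (P *v u) $ k - u $ k - ((P *v u) $ k + 1) * d $ k + (P *v rd) $ k" for k
      proof -
        define s where "s = 1 - (\<Sum>l\<in>UNIV. P $ k $ l)"
        have "s \<ge> 0" and P0: "P $ k $ l \<ge> 0" for l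
          using P by (auto simp: s_def substochastic_def)
        have exp_d: "exp (d $ l - d $ k) = exp (- d $ k) * exp (d $ l)" for l
          by (simp flip: exp_add)
        have "exp (- y $ k) * r k = exp (- d $ k)"
          using exp_y[of k] r[of k] by (simp add: exp_minus field_simps)
        then have "r k * h P k y
            = exp (- d $ k) * ((\<Sum>l\<in>UNIV. (exp (y $ l) - 1) * P $ k $ l) + 1) - r k"
          unfolding h_def by (simp add: algebra_simps)
        also have "(\<Sum>l\<in>UNIV. (exp (y $ l) - 1) * P $ k $ l) + 1
            = (\<Sum>l\<in>UNIV. P $ k $ l * r l * exp (d $ l)) + s"
          by (simp add: s_def exp_y algebra_simps sum_subtractf)
        also have "exp (- d $ k) * ((\<Sum>l\<in>UNIV. P $ k $ l * r l * exp (d $ l)) + s)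
            = (\<Sum>l\<in>UNIV. P $ k $ l * r l * exp (d $ l - d $ k)) + s * exp (- d $ k)"
          by (simp add: exp_d distrib_left sum_distrib_left mult_ac)
        finally have "r k * h P k y
            = (\<Sum>l\<in>UNIV. P $ k $ l * r l * exp (d $ l - d $ k)) + s * exp (- d $ k) - r k" .
        moreover have "(\<Sum>l\<in>UNIV. P $ k $ l * r l * (1 + (d $ l - d $ k)))
            \<le> (\<Sum>l\<in>UNIV. P $ k $ l * r l * exp (d $ l - d $ k))"
          using P0 r by (intro sum_mono mult_left_mono tangent) (simp add: less_imp_le)
        moreover have "s * (1 + - d $ k) \<le> s * exp (- d $ k)"
          using \<open>s \<ge> 0\<close> by (intro mult_left_mono tangent)
        moreover have "(\<Sum>l\<in>UNIV. P $ k $ l * r l * (1 + (d $ l - d $ k)))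
            = (\<Sum>l\<in>UNIV. P $ k $ l * r l) * (1 - d $ k) + (P *v rd) $ k"
          by (simp add: matrix_vector_mult_def rd_def sum_distrib_right flip: sum.distrib)
             (simp add: algebra_simps)
        moreover have "(\<Sum>l\<in>UNIV. P $ k $ l * r l) = (P *v u) $ k + (1 - s)"
          by (simp add: matrix_vector_mult_def r_def s_def distrib_left sum.distrib)
        ultimately have "r k * h P k y
            \<ge> ((P *v u) $ k + (1 - s)) * (1 - d $ k) + (P *v rd) $ k + s * (1 + - d $ k) - r k"
          by simp
        then show ?thesis by (simp add: r_def algebra_simps)
      qed
      \<comment> \<open>Here \<open>bound\<close> enters: the factor rho_k r_k lies in [0, 1], so
        multiplying h_k by it cannot exceed the positive part.\<close>
      have J: "(\<Sum>k\<in>J. ?nu k * (r k * h P k y)) \<le> (\<Sum>k\<in>J. max (h P k y) 0 * mu $ k)"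
      proof (rule sum_mono)
        fix k assume "k \<in> J"
        then have "rho P lam mu $ k * r k \<le> 1" using bound by (simp add: r_def)
        moreover have "0 \<le> rho P lam mu $ k * r k"
          using rho[of k] r[of k] by simp
        ultimately have "rho P lam mu $ k * r k * h P k y \<le> max (h P k y) 0"
          by (cases "h P k y \<ge> 0") (auto simp: mult_left_le_one_le mult_nonneg_nonpos)
        then have "rho P lam mu $ k * r k * h P k y * mu $ k \<le> max (h P k y) 0 * mu $ k"
          using mu[of k] by (intro mult_right_mono) auto
        then show "?nu k * (r k * h P k y) \<le> max (h P k y) 0 * mu $ k"
          by (simp add: mult_ac flip: rho_mu)
      qed
      have off_J: "(\<Sum>k\<in>-J. ?nu k * (r k * h P k \<eta>)) = (\<Sum>k\<in>-J. h P k \<eta> * mu $ k)" for \<eta>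
        by (rule sum.cong) (auto simp: mu_off)
      have split: "(\<Sum>k\<in>UNIV. f k) = (\<Sum>k\<in>J. f k) + (\<Sum>k\<in>-J. f k)" for f :: "'k \<Rightarrow> real"
        by (subst sum.union_disjoint[symmetric]) auto
      have H\<theta>: "?H ?\<theta> = (\<Sum>k\<in>UNIV. u $ k * lam $ k) + (\<Sum>k\<in>UNIV. ?nu k * ((P *v u) $ k - u $ k))"
      proof -
        have "?nu k * ((P *v u) $ k - u $ k) = ?nu k * (r k * h P k ?\<theta>)" for k
          using r[of k] by (simp add: h0)
        then have "(\<Sum>k\<in>UNIV. ?nu k * ((P *v u) $ k - u $ k))
            = (\<Sum>k\<in>J. ?nu k * ((P *v u) $ k - u $ k)) + (\<Sum>k\<in>-J. h P k ?\<theta> * mu $ k)"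
          by (subst split) (simp only: off_J)
        then show ?thesis by (simp add: H0 harm)
      qed
      \<comment> \<open>The \<open>P *v rd\<close> terms cancel. The first sum on the right is the
        arrival term in \<open>rd\<close>, by \<open>nu_inner_eq\<close>.\<close>
      have "(\<Sum>k\<in>UNIV. ?nu k * ((P *v u) $ k - u $ k)) + v \<bullet> d
          = (\<Sum>k\<in>UNIV. ?nu k * (rd $ k - (P *v rd) $ k))
            + (\<Sum>k\<in>UNIV. ?nu k * ((P *v u) $ k - u $ k - ((P *v u) $ k + 1) * d $ k + (P *v rd) $ k))"
        unfolding inner_vec_def sum.distrib[symmetric]
        by (rule sum.cong) (simp_all add: v_def rd_def r_def algebra_simps)
      then have "?H ?\<theta> + v \<bullet> d
          = (\<Sum>k\<in>UNIV. u $ k * lam $ k) + (\<Sum>k\<in>UNIV. rd $ k * lam $ k)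
            + (\<Sum>k\<in>UNIV. ?nu k * ((P *v u) $ k - u $ k - ((P *v u) $ k + 1) * d $ k + (P *v rd) $ k))"
        unfolding H\<theta> nu_inner_eq[OF P spec, of rd] by linarith
      also have "\<dots> \<le> (\<Sum>k\<in>UNIV. (exp (y $ k) - 1) * lam $ k) + (\<Sum>k\<in>UNIV. ?nu k * (r k * h P k y))"
      proof (rule add_mono)
        show "(\<Sum>k\<in>UNIV. u $ k * lam $ k) + (\<Sum>k\<in>UNIV. rd $ k * lam $ k)
            \<le> (\<Sum>k\<in>UNIV. (exp (y $ k) - 1) * lam $ k)"
          unfolding sum.distrib[symmetric] by (rule sum_mono) (rule arrivals)
      qed (intro sum_mono mult_left_mono services less_imp_le[OF nu])
      also have "\<dots> \<le> ?H y"
        unfolding H_def split[of "\<lambda>k. ?nu k * (r k * h P k y)"] off_J using J by simp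
      finally show ?thesis by (simp add: d_def)
    qed
    moreover have "\<forall>j\<in>J. v $ j = 0" by (simp add: v_def harm)
    ultimately show "\<exists>v\<in>subdifferential ?H ?\<theta>. \<forall>j\<in>J. v $ j = 0"
      by (auto simp: subdifferential_def)
  qed
qed

section \<open>Reduction of both criteria to one inequality\<close>

theorem mainTheorem2:
  fixes P :: "real^'k^'k" and lam mu :: "real^'k" and J :: "'k set"
  assumes "substochastic P" and "spectral_radius P < 1"
    and "\<And>k. lam $ k > 0" and "\<And>k. mu $ k > 0"
    and "\<And>k. rho P lam mu $ k < 1"
  shows "(essential P lam mu J \<longleftrightarrow> (\<forall>l\<in>J. rho_tilde P lam mu J l \<ge> rho P lam mu $ l)) \<and>
    (essential P lam mu J \<longleftrightarrow>
      (\<forall>l\<in>J. inverse (rho P lam mu $ l) - 1 \<ge>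
        ((submat_inv J (submat_one J - submat J J P) ** submat J (-J) P)
          *v subvec (-J) (\<chi> m. inverse (rho P lam mu $ m) - 1)) $ l))"
proof -
  note P = assms(1) and spec = assms(2)
  define z where "z = subvec (-J) (\<chi> m. inverse (rho P lam mu $ m) - 1)"
  define y where "y = (submat_inv J (submat_one J - submat J J P) ** submat J (-J) P) *v z"
  \<comment> \<open>The boundary data \<open>z\<close> off \<open>J\<close> together with their
    extension \<open>y\<close> on \<open>J\<close>; this is exp \<theta> - 1 at the
    momentum.\<close>
  define u where "u = y + z"
  have rho: "rho P lam mu $ k > 0" for k
    using nu_pos[OF P spec assms(3)] assms(4) by (simp add: rho_def)
  have z0: "z $ k \<ge> 0" for k
    using rho[of k] assms(5)[of k] by (simp add: z_def subvec_def one_le_inverse)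
  have y: "y = submat_inv J (submat_one J - submat J J P) *v (submat J (-J) P *v z)"
    by (simp add: y_def matrix_vector_mul_assoc)
  have y_off: "y $ k = 0" if "k \<notin> J" for k
    using submat_inv_solves(1)[OF P spec that] by (simp add: y)
  have y_on: "y $ k = (P *v y) $ k + (P *v z) $ k" if "k \<in> J" for k
  proof -
    have "(submat J (-J) P *v z) $ k = (P *v z) $ k"
      using that by (auto simp: matrix_vector_mult_def submat_def z_def subvec_def intro!: sum.cong)
    then show ?thesis
      using submat_inv_solves(2)[OF P spec that, of "submat J (-J) P *v z"] by (simp flip: y)
  qed
  have "(P *v z) $ k \<ge> 0" for k
    using P z0 by (auto simp: matrix_vector_mult_def substochastic_def intro!: sum_nonneg)
  then have y0: "y $ k \<ge> 0" for k
    using minimum_principle[OF P spec, of J y k] y_off y_on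
    by (metis le_add_same_cancel1)
  have u0: "u $ k \<ge> 0" for k using y0 z0 by (simp add: u_def)
  have u_off: "u $ k = inverse (rho P lam mu $ k) - 1" if "k \<notin> J" for k
    using that by (simp add: u_def y_off z_def subvec_def)
  have u_on: "u $ k = y $ k" if "k \<in> J" for k
    using that by (simp add: u_def z_def subvec_def)
  have harm: "(P *v u) $ k = u $ k" if "k \<in> J" for k
    using y_on[OF that] by (simp add: u_on[OF that]) (simp add: u_def matrix_vector_right_distrib)
  have theta: "theta_tilde P lam mu J = (\<chi> k. ln (1 + u $ k))"
    by (rule theta_tilde_eq[OF P spec rho u0 u_off harm])
  have ess: "essential P lam mu J \<longleftrightarrow> (\<forall>l\<in>J. rho P lam mu $ l * (1 + u $ l) \<le> 1)"
    unfolding essential_iff_subgradient theta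
    by (rule subgradient_vanishing_on_iff[OF P spec assms(3,4) u0 u_off harm])
  have "rho_tilde P lam mu J l \<ge> rho P lam mu $ l \<longleftrightarrow> rho P lam mu $ l * (1 + u $ l) \<le> 1" for l
  proof -
    have "rho_tilde P lam mu J l = 1 / (1 + u $ l)"
      using u0[of l] by (simp add: rho_tilde_def theta exp_minus inverse_eq_divide)
    then show ?thesis using u0[of l] by (simp add: le_divide_eq)
  qed
  moreover have "inverse (rho P lam mu $ l) - 1 \<ge> y $ l \<longleftrightarrow> rho P lam mu $ l * (1 + u $ l) \<le> 1"
    if "l \<in> J" for l
    using rho[of l] by (simp add: u_on[OF that] field_simps)
  ultimately show ?thesis
    unfolding ess y_def[symmetric] z_def[symmetric] by auto
qed

end
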